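(* For every feasible instance of the Mobile Production Vehicle Routing Problem (MoP-VRP), there exists an optimal solution such that the schedule of each machine is in line with the route of the vehicle carrying the machine; that is, for every vehicle $k$, every machine $l$ on vehicle $k$, and any two customers $i,j$ whose orders are both produced on machine $l$ of vehicle $k$, the order of $i$ is produced before the order of $j$ on that machine if and only if $i$ is visited before $j$ on the route of $k$.
   Context: **MoP-VRP instance.** A graph with node set $V=\{0\}\cup C$, where $0$ is the depot and $C=\{1,\dots,n\}$ is the set of customers, and edge set $E$; each edge $(i,j)\in E$ has a distance $c_{ij}\ge 0$ and a travel time $t_{ij}\ge 0$. There is a set $K=\{1,\dots,\kappa\}$ of identical vehicles, each of capacity $Q$ and each carrying a set $M=\{1,\dots,m\}$ of identical machines. Each customer $i\in C$ has a demand $d_i\ge 0$, a production time $p_i\ge 0$, a service time $e_i\ge 0$, and a time window $[a_i,b_i]$ whose start $a_i$ is strict and whose end $b_i$ is soft. There is a latest return time $D$ and there are weights $\omega_1,\omega_2\ge 0$. **Solution.** A solution consists of: (i) for each vehicle, one route (a possibly empty ordered list of customers, starting from and ending at the depot along edges of $E$), such that each customer lies on exactly one route and the total demand of the customers on each route is at most $Q$; (ii) for each vehicle, an assignment of each customer on its route to one of the $m$ machines on that vehicle, together with, for each machine, a sequence (the machine's schedule) in which the orders assigned to it are produced. Each machine processes one order at a time, without interruption, consecutively from time $0$; producing customer $i$'s order takes $p_i$ time. **Timing.** Each vehicle departs from the depot at time $0$. The service start time $s_i$ at customer $i$ is the maximum of the vehicle's arrival time at $i$, the completion time of production of $i$'s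 order, and $a_i$. The vehicle leaves $i$ at time $s_i+e_i$ and travels to the next node in time $t_{ij}$. The solution is feasible if every vehicle returns to the depot no later than time $D$. An instance is feasible if it has a feasible solution. **Objective.** The delay at customer $i$ is $y_i=\max\{0,s_i-b_i\}$. The objective, to be minimized over feasible solutions, is $\omega_1\cdot(\text{total distance } c \text{ of all routes})+\omega_2\sum_{i\in C}y_i$. An optimal solution is a feasible solution attaining the minimum. *)

theory Defs
  imports Complex_Main
begin

section \<open>Instances\<close>

text \<open>
  Nodes are natural numbers: the depot is 0 and the customers are 1, ..., n. Edges are ordered
  pairs, so that distances and travel times may be asymmetric; an undirected graph is the special
  case of a symmetric edge set.
\<close>

record mop_vrp =
  num_customers :: nat
  edges :: "(nat \<times> nat) set"
  dist_of :: "nat \<Rightarrow> nat \<Rightarrow> real"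
  travel_time :: "nat \<Rightarrow> nat \<Rightarrow> real"
  num_vehicles :: nat
  capacity :: real
  num_machines :: nat
  demand :: "nat \<Rightarrow> real"
  prod_time :: "nat \<Rightarrow> real"
  service_time :: "nat \<Rightarrow> real"
  window_start :: "nat \<Rightarrow> real"
  window_end :: "nat \<Rightarrow> real"
  latest_return :: real
  weight_dist :: real
  weight_delay :: real

definition customers :: "mop_vrp \<Rightarrow> nat set" where
  "customers I = {1..num_customers I}"

definition nodes :: "mop_vrp \<Rightarrow> nat set" where
  "nodes I = {0} \<union> customers I"

definition vehicles :: "mop_vrp \<Rightarrow> nat set" where
  "vehicles I = {1..num_vehicles I}"

definition machines :: "mop_vrp \<Rightarrow> nat set" where
  "machines I = {1..num_machines I}"

definition mop_vrp_instance :: "mop_vrp \<Rightarrow> bool" where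
  "mop_vrp_instance I \<longleftrightarrow>
     edges I \<subseteq> nodes I \<times> nodes I \<and>
     (\<forall>(i, j) \<in> edges I. 0 \<le> dist_of I i j \<and> 0 \<le> travel_time I i j) \<and>
     (\<forall>i \<in> customers I. 0 \<le> demand I i \<and> 0 \<le> prod_time I i \<and> 0 \<le> service_time I i) \<and>
     0 \<le> weight_dist I \<and> 0 \<le> weight_delay I"


section \<open>Solutions\<close>

text \<open>
  Values for indices that are not vehicles, machines or (for the machine assignment) customers
  on the route of the vehicle are irrelevant.
\<close>

record mop_solution =
  route :: "nat \<Rightarrow> nat list"                  \<comment> \<open>vehicle; the depot is not listed\<close>
  machine_of :: "nat \<Rightarrow> nat \<Rightarrow> nat"           \<comment> \<open>vehicle, customer\<close>
  schedule :: "nat \<Rightarrow> nat \<Rightarrow> nat list"        \<comment> \<open>vehicle, machine\<close>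

text \<open>An empty route means that the vehicle stays at the depot and uses no edge.\<close>

definition legs :: "nat list \<Rightarrow> (nat \<times> nat) list" where
  "legs r = (if r = [] then [] else zip (0 # r) (r @ [0]))"

definition solution :: "mop_vrp \<Rightarrow> mop_solution \<Rightarrow> bool" where
  "solution I S \<longleftrightarrow>
     (\<forall>k \<in> vehicles I.
        distinct (route S k) \<and>
        set (route S k) \<subseteq> customers I \<and>
        set (legs (route S k)) \<subseteq> edges I \<and>
        (\<Sum>i\<leftarrow>route S k. demand I i) \<le> capacity I \<and>
        (\<forall>i \<in> set (route S k). machine_of S k i \<in> machines I) \<and>
        (\<forall>l \<in> machines I.
           distinct (schedule S k l) \<and>
           set (schedule S k l) = {i \<in> set (route S k). machine_of S k i = l})) \<and>
     (\<forall>i \<in> customers I. \<exists>!k. k \<in> vehicles I \<and> i \<in> set (route S k))"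


section \<open>Timing\<close>

definition completion_time :: "mop_vrp \<Rightarrow> nat list \<Rightarrow> nat \<Rightarrow> real" where
  "completion_time I \<sigma> i = (\<Sum>j\<leftarrow>takeWhile (\<lambda>j. j \<noteq> i) \<sigma>. prod_time I j) + prod_time I i"

definition order_completion :: "mop_vrp \<Rightarrow> mop_solution \<Rightarrow> nat \<Rightarrow> nat \<Rightarrow> real" where
  "order_completion I S k i = completion_time I (schedule S k (machine_of S k i)) i"

text \<open>Service start time at the customer in position \<open>q\<close> (counted from 0) of the route.\<close>

fun start_at :: "mop_vrp \<Rightarrow> mop_solution \<Rightarrow> nat \<Rightarrow> nat \<Rightarrow> real" where
  "start_at I S k 0 =
     (let i = route S k ! 0
      in max (travel_time I 0 i) (max (order_completion I S k i) (window_start I i)))"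
| "start_at I S k (Suc q) =
     (let h = route S k ! q; i = route S k ! Suc q
      in max (start_at I S k q + service_time I h + travel_time I h i)
           (max (order_completion I S k i) (window_start I i)))"

definition return_time :: "mop_vrp \<Rightarrow> mop_solution \<Rightarrow> nat \<Rightarrow> real" where
  "return_time I S k =
     (let r = route S k
      in if r = [] then 0
         else start_at I S k (length r - 1) + service_time I (last r) + travel_time I (last r) 0)"

definition vehicle_of :: "mop_vrp \<Rightarrow> mop_solution \<Rightarrow> nat \<Rightarrow> nat" where
  "vehicle_of I S i = (THE k. k \<in> vehicles I \<and> i \<in> set (route S k))"

text \<open>The length of the \<open>takeWhile\<close> prefix is the position of \<open>i\<close> on the route.\<close>

definition service_start :: "mop_vrp \<Rightarrow> mop_solution \<Rightarrow> nat \<Rightarrow> real" where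
  "service_start I S i =
     (let k = vehicle_of I S i
      in start_at I S k (length (takeWhile (\<lambda>j. j \<noteq> i) (route S k))))"

definition feasible_solution :: "mop_vrp \<Rightarrow> mop_solution \<Rightarrow> bool" where
  "feasible_solution I S \<longleftrightarrow>
     solution I S \<and> (\<forall>k \<in> vehicles I. return_time I S k \<le> latest_return I)"

definition feasible_instance :: "mop_vrp \<Rightarrow> bool" where
  "feasible_instance I \<longleftrightarrow> (\<exists>S. feasible_solution I S)"


section \<open>Objective\<close>

definition delay :: "mop_vrp \<Rightarrow> mop_solution \<Rightarrow> nat \<Rightarrow> real" where
  "delay I S i = max 0 (service_start I S i - window_end I i)"

definition total_distance :: "mop_vrp \<Rightarrow> mop_solution \<Rightarrow> real" where
  "total_distance I S = (\<Sum>k\<in>vehicles I. \<Sum>(i, j)\<leftarrow>legs (route S k). dist_of I i j)"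

definition objective :: "mop_vrp \<Rightarrow> mop_solution \<Rightarrow> real" where
  "objective I S =
     weight_dist I * total_distance I S + weight_delay I * (\<Sum>i\<in>customers I. delay I S i)"

definition optimal_solution :: "mop_vrp \<Rightarrow> mop_solution \<Rightarrow> bool" where
  "optimal_solution I S \<longleftrightarrow>
     feasible_solution I S \<and>
     (\<forall>S'. feasible_solution I S' \<longrightarrow> objective I S \<le> objective I S')"


section \<open>Order of production and of visits\<close>

definition before_in :: "'a list \<Rightarrow> 'a \<Rightarrow> 'a \<Rightarrow> bool" where
  "before_in xs x y \<longleftrightarrow> (\<exists>u v. u < v \<and> v < length xs \<and> xs ! u = x \<and> xs ! v = y)"

end

theory Submission imports Defs begin

text \<open>
  The proof is an exchange argument followed by a finiteness argument.

  Keep the routes and the machine assignment of a feasible solution, and let every machine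
  produce its orders in the order in which the vehicle visits them. No service starts later than
  before. Indeed, for a customer \<open>i\<close> let \<open>B\<close> be the set of customers visited no later than
  \<open>i\<close> whose orders are produced on the same machine as that of \<open>i\<close>. In route order, \<open>i\<close> is
  completed after exactly the total production time of \<open>B\<close>. In the given schedule, whichever
  member \<open>j\<close> of \<open>B\<close> is produced last is completed
  no earlier than that (\<open>completion_time_of_last_ge\<close>); the vehicle waits for this completion at \<open>j\<close>,
  which it visits no later than \<open>i\<close>, and it never travels back in time
  (\<open>start_at_mono\<close>). So the new production of \<open>i\<close> cannot delay the vehicle at \<open>i\<close> beyond
  the old service start (\<open>start_at_align_le\<close>). Hence the aligned solution is feasible, and its
  objective value is no larger.

  An aligned solution is determined by the routes and the machine assignment, so only finitely many
  exist (\<open>finite_aligned_solutions\<close>). A best one among them is optimal among all solutions.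
  This also gives existence of an optimum, which is not evident beforehand, since
  the values of a solution at irrelevant indices allow infinitely many feasible solutions.
\<close>

section \<open>Order within a list\<close>

lemma before_in_Nil [simp]: "\<not> before_in [] x y"
  by (simp add: before_in_def)

lemma before_in_Cons:
  "before_in (z # zs) x y \<longleftrightarrow> x = z \<and> y \<in> set zs \<or> before_in zs x y"
proof
  assume "before_in (z # zs) x y"
  then obtain u v where uv: "u < v" "v < Suc (length zs)" "(z # zs) ! u = x" "(z # zs) ! v = y"
    by (auto simp: before_in_def)
  then obtain v' where v': "v = Suc v'" by (cases v) auto
  show "x = z \<and> y \<in> set zs \<or> before_in zs x y"
  proof (cases u)
    case 0
    with uv v' show ?thesis by auto
  next
    case (Suc u')
    with uv v' show ?thesis by (auto simp: before_in_def)
  qed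
next
  assume "x = z \<and> y \<in> set zs \<or> before_in zs x y"
  then show "before_in (z # zs) x y"
  proof
    assume "x = z \<and> y \<in> set zs"
    then obtain v where "v < length zs" "zs ! v = y" "x = z" by (auto simp: in_set_conv_nth)
    then have "0 < Suc v \<and> Suc v < length (z # zs) \<and> (z # zs) ! 0 = x \<and> (z # zs) ! Suc v = y"
      by simp
    then show ?thesis unfolding before_in_def by blast
  next
    assume "before_in zs x y"
    then obtain u v where "u < v" "v < length zs" "zs ! u = x" "zs ! v = y"
      by (auto simp: before_in_def)
    then have "Suc u < Suc v \<and> Suc v < length (z # zs) \<and>
        (z # zs) ! Suc u = x \<and> (z # zs) ! Suc v = y"
      by simp
    then show ?thesis unfolding before_in_def by blast
  qed
qed

lemma before_in_filter:
  "before_in (filter P xs) x y \<longleftrightarrow> P x \<and> P y \<and> before_in xs x y"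
  by (induction xs) (auto simp: before_in_Cons)


section \<open>Completion times on one machine\<close>

lemma completion_time_append:
  assumes "i \<notin> set ys"
  shows "completion_time I (ys @ i # zs) i = (\<Sum>j\<leftarrow>ys @ [i]. prod_time I j)"
proof -
  have "takeWhile (\<lambda>j. j \<noteq> i) (ys @ i # zs) = ys"
    using assms by (subst takeWhile_append2) auto
  then show ?thesis by (simp add: completion_time_def)
qed

text \<open>
  Whatever the schedule, all of \<open>B\<close> has been produced when its last member is completed, and
  the machine needs at least the total production time of \<open>B\<close> for that.
\<close>

lemma completion_time_of_last_ge:
  assumes "distinct \<sigma>" and "\<And>j. j \<in> set \<sigma> \<Longrightarrow> 0 \<le> prod_time I j"
    and "B \<subseteq> set \<sigma>" and "B \<noteq> {}"
  obtains j where "j \<in> B" and "(\<Sum>i\<in>B. prod_time I i) \<le> completion_time I \<sigma> j"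
proof -
  have "\<exists>j\<in>set \<sigma>. j \<in> B" using assms(3,4) by blast
  then obtain ys j zs where split: "\<sigma> = ys @ j # zs" "j \<in> B" "\<forall>z\<in>set zs. z \<notin> B"
    by (rule split_list_last_propE)
  have "(\<Sum>i\<in>B. prod_time I i) \<le> (\<Sum>i\<in>set (ys @ [j]). prod_time I i)"
  proof (rule sum_mono2)
    show "B \<subseteq> set (ys @ [j])" using assms(3) split by auto
  qed (use assms(2) split in auto)
  also have "\<dots> = (\<Sum>i\<leftarrow>ys @ [j]. prod_time I i)"
    using assms(1) split by (subst sum_list_distinct_conv_sum_set) auto
  also have "\<dots> = completion_time I \<sigma> j"
    using assms(1) split by (simp add: completion_time_append)
  finally show ?thesis using split(2) that by blast
qed

lemma completion_time_filter:
  assumes "distinct r" and "q < length r" and "P (r ! q)"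
  shows "completion_time I (filter P r) (r ! q) =
    (\<Sum>j\<in>{j \<in> set (take (Suc q) r). P j}. prod_time I j)"
proof -
  let ?i = "r ! q" and ?ys = "filter P (take q r)"
  have r: "r = take q r @ ?i # drop (Suc q) r"
    using assms(2) by (rule id_take_nth_drop)
  have "distinct (take q r @ ?i # drop (Suc q) r)"
    using assms(1) r by metis
  then have notin: "?i \<notin> set ?ys" and dist: "distinct ?ys" by auto
  have "filter P r = ?ys @ ?i # filter P (drop (Suc q) r)"
    using assms(3) by (subst r) simp
  then have "completion_time I (filter P r) ?i = (\<Sum>j\<leftarrow>?ys @ [?i]. prod_time I j)"
    using completion_time_append[OF notin] by metis
  also have "\<dots> = (\<Sum>j\<in>set (?ys @ [?i]). prod_time I j)"
    using notin dist by (subst sum_list_distinct_conv_sum_set) auto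
  also have "set (?ys @ [?i]) = {j \<in> set (take (Suc q) r). P j}"
    using assms(2,3) by (auto simp: take_Suc_conv_app_nth)
  finally show ?thesis .
qed


section \<open>Service start times along a route\<close>

lemma order_completion_le_start_at:
  "order_completion I S k (route S k ! q) \<le> start_at I S k q"
  by (cases q) (auto simp: Let_def)

lemma legs_consecutive:
  assumes "Suc q < length r"
  shows "(r ! q, r ! Suc q) \<in> set (legs r)"
proof -
  have "legs r ! Suc q = (r ! q, r ! Suc q)" and "Suc q < length (legs r)"
    using assms by (auto simp: legs_def nth_append)
  then show ?thesis by (metis nth_mem)
qed

text \<open>
  Each step of the recursion adds a service time and a travel time. An instance guarantees a
  nonnegative travel time only on its edges, so the route has to follow edges.
\<close>

lemma start_at_mono:
  assumes inst: "mop_vrp_instance I" and sol: "solution I S" and k: "k \<in> vehicles I"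
    and "u \<le> v" and "v < length (route S k)"
  shows "start_at I S k u \<le> start_at I S k v"
  using assms(4,5)
proof (induction v rule: dec_induct)
  case base
  show ?case by simp
next
  case (step v)
  have "(route S k ! v, route S k ! Suc v) \<in> edges I"
    using legs_consecutive[OF step.prems] sol k by (auto simp: solution_def)
  then have "0 \<le> travel_time I (route S k ! v) (route S k ! Suc v)"
    using inst by (auto simp: mop_vrp_instance_def)
  moreover have "route S k ! v \<in> set (route S k)"
    using step.prems by (simp add: Suc_lessD)
  then have "route S k ! v \<in> customers I"
    using sol k by (auto simp: solution_def)
  then have "0 \<le> service_time I (route S k ! v)"
    using inst by (auto simp: mop_vrp_instance_def)
  ultimately have "start_at I S k v \<le> start_at I S k (Suc v)"
    by (simp add: Let_def)
  with step show ?case by simp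
qed


section \<open>Aligning the schedules with the routes\<close>

definition in_route_order ::
  "(nat \<Rightarrow> nat list) \<Rightarrow> (nat \<Rightarrow> nat \<Rightarrow> nat) \<Rightarrow> mop_solution" where
  "in_route_order r a =
     \<lparr>route = r, machine_of = a, schedule = (\<lambda>k l. filter (\<lambda>i. a k i = l) (r k))\<rparr>"

text \<open>
  Irrelevant values are reset to fixed ones, so that only finitely many solutions are of this form.
\<close>

definition align :: "mop_vrp \<Rightarrow> mop_solution \<Rightarrow> mop_solution" where
  "align I S = in_route_order
     (\<lambda>k. if k \<in> vehicles I then route S k else [])
     (\<lambda>k i. if k \<in> vehicles I \<and> i \<in> set (route S k) then machine_of S k i else 0)"

lemma route_align [simp]: "k \<in> vehicles I \<Longrightarrow> route (align I S) k = route S k"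
  by (simp add: align_def in_route_order_def)

lemma machine_of_align [simp]:
  "\<lbrakk>k \<in> vehicles I; i \<in> set (route S k)\<rbrakk> \<Longrightarrow> machine_of (align I S) k i = machine_of S k i"
  by (simp add: align_def in_route_order_def)

lemma schedule_align [simp]:
  "k \<in> vehicles I \<Longrightarrow>
    schedule (align I S) k l = filter (\<lambda>i. machine_of S k i = l) (route S k)"
  by (auto simp: align_def in_route_order_def intro: filter_cong)

lemma solution_align:
  assumes "solution I S"
  shows "solution I (align I S)"
proof -
  have "(\<exists>!k. k \<in> vehicles I \<and> i \<in> set (route (align I S) k)) \<longleftrightarrow>
      (\<exists>!k. k \<in> vehicles I \<and> i \<in> set (route S k))" for i
    by (metis route_align)
  then show ?thesis using assms by (auto simp: solution_def)
qed

text \<open>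
  The set \<open>B\<close> of customers visited no later than \<open>i\<close> whose orders share its machine takes that
  machine the same total time in both solutions. In the given one, the vehicle has waited for all
  of \<open>B\<close> by the time it serves \<open>i\<close>.
\<close>

lemma order_completion_align_le:
  assumes inst: "mop_vrp_instance I" and sol: "solution I S" and k: "k \<in> vehicles I"
    and q: "q < length (route S k)"
  shows "order_completion I (align I S) k (route S k ! q) \<le> start_at I S k q"
proof -
  define r where "r = route S k"
  define l where "l = machine_of S k (r ! q)"
  define B where "B = {j \<in> set (take (Suc q) r). machine_of S k j = l}"
  have iq: "r ! q \<in> set r" and q': "q < length r" using q by (auto simp: r_def)
  have dist: "distinct r" and "set r \<subseteq> customers I"
    using sol k by (auto simp: solution_def r_def)
  have "l \<in> machines I" using sol k iq by (auto simp: solution_def r_def l_def)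
  then have sched: "distinct (schedule S k l)"
      "set (schedule S k l) = {i \<in> set r. machine_of S k i = l}"
    using sol k by (auto simp: solution_def r_def)
  have "r ! q \<in> B" using q' by (auto simp: B_def l_def take_Suc_conv_app_nth)
  moreover have "B \<subseteq> set (schedule S k l)"
    using sched(2) by (auto simp: B_def dest: in_set_takeD)
  moreover have "0 \<le> prod_time I j" if "j \<in> set (schedule S k l)" for j
    using that sched(2) \<open>set r \<subseteq> customers I\<close> inst by (auto simp: mop_vrp_instance_def)
  ultimately obtain j where j: "j \<in> B"
      "(\<Sum>i\<in>B. prod_time I i) \<le> completion_time I (schedule S k l) j"
    using completion_time_of_last_ge[OF sched(1)] by (metis empty_iff)
  obtain u where u: "u \<le> q" "r ! u = j"
    using j(1) by (auto simp: B_def in_set_conv_nth less_Suc_eq_le)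
  have "order_completion I (align I S) k (r ! q) =
      completion_time I (filter (\<lambda>i. machine_of S k i = l) r) (r ! q)"
    using k iq by (simp add: order_completion_def l_def r_def)
  also have "\<dots> = (\<Sum>i\<in>B. prod_time I i)"
    unfolding B_def by (rule completion_time_filter[OF dist q']) (simp add: l_def)
  also have "\<dots> \<le> order_completion I S k (r ! u)"
    using j u(2) by (simp add: order_completion_def B_def)
  also have "\<dots> \<le> start_at I S k u"
    unfolding r_def by (rule order_completion_le_start_at)
  also have "\<dots> \<le> start_at I S k q"
    using start_at_mono[OF inst sol k u(1) q] .
  finally show ?thesis by (simp add: r_def)
qed

lemma start_at_align_le:
  assumes "mop_vrp_instance I" and "solution I S" and "k \<in> vehicles I"
    and "q < length (route S k)"
  shows "start_at I (align I S) k q \<le> start_at I S k q"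
  using assms(4)
proof (induction q)
  case 0
  with order_completion_align_le[OF assms(1-3), of 0] assms(3) show ?case
    by (auto simp: Let_def)
next
  case (Suc q)
  then have "start_at I (align I S) k q \<le> start_at I S k q" by simp
  with order_completion_align_le[OF assms(1-3) Suc.prems] assms(3) show ?case
    by (auto simp: Let_def)
qed

lemma feasible_solution_align:
  assumes "mop_vrp_instance I" and "feasible_solution I S"
  shows "feasible_solution I (align I S)"
proof -
  have sol: "solution I S" using assms(2) by (simp add: feasible_solution_def)
  have "return_time I (align I S) k \<le> return_time I S k" if "k \<in> vehicles I" for k
    using start_at_align_le[OF assms(1) sol that, of "length (route S k) - 1"] that
    by (simp add: return_time_def Let_def)
  then show ?thesis
    using assms(2) solution_align[OF sol] by (fastforce simp: feasible_solution_def)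
qed

lemma service_start_align_le:
  assumes "mop_vrp_instance I" and sol: "solution I S" and i: "i \<in> customers I"
  shows "service_start I (align I S) i \<le> service_start I S i"
proof -
  define k where "k = vehicle_of I S i"
  have same: "vehicle_of I (align I S) i = k"
    unfolding vehicle_of_def k_def by (metis route_align)
  have "\<exists>!k. k \<in> vehicles I \<and> i \<in> set (route S k)"
    using sol i by (simp add: solution_def)
  then have k: "k \<in> vehicles I" "i \<in> set (route S k)"
    unfolding k_def vehicle_of_def by (metis (mono_tags, lifting) theI')+
  then have "length (takeWhile (\<lambda>j. j \<noteq> i) (route S k)) < length (route S k)"
    by (metis (mono_tags, lifting) length_takeWhile_le le_neq_implies_less
        takeWhile_eq_all_conv takeWhile_eq_take take_all order_refl)
  from start_at_align_le[OF assms(1) sol k(1) this] k(1) show ?thesis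
    by (simp add: service_start_def same k_def[symmetric])
qed

lemma objective_align_le:
  assumes "mop_vrp_instance I" and "solution I S"
  shows "objective I (align I S) \<le> objective I S"
proof -
  have "total_distance I (align I S) = total_distance I S"
    unfolding total_distance_def by (intro sum.cong) auto
  moreover have "(\<Sum>i\<in>customers I. delay I (align I S) i) \<le> (\<Sum>i\<in>customers I. delay I S i)"
    using service_start_align_le[OF assms] by (intro sum_mono) (force simp: delay_def)
  moreover have "0 \<le> weight_delay I" using assms(1) by (simp add: mop_vrp_instance_def)
  ultimately show ?thesis by (simp add: objective_def mult_left_mono)
qed


section \<open>Finitely many aligned solutions\<close>

lemma finite_distinct_lists:
  assumes "finite A"
  shows "finite {xs. set xs \<subseteq> A \<and> distinct xs}"
proof (rule finite_subset)
  show "{xs. set xs \<subseteq> A \<and> distinct xs} \<subseteq> {xs. set xs \<subseteq> A \<and> length xs \<le> card A}"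
    using assms by (auto simp: distinct_card[symmetric] intro: card_mono)
  show "finite {xs. set xs \<subseteq> A \<and> length xs \<le> card A}"
    using assms by (rule finite_lists_length_le)
qed

lemma finite_aligned_solutions: "finite (align I ` {S. solution I S})"
proof -
  let ?L = "{xs. set xs \<subseteq> customers I \<and> distinct xs}"
  let ?R = "{r. \<forall>k. (k \<in> vehicles I \<longrightarrow> r k \<in> ?L) \<and> (k \<notin> vehicles I \<longrightarrow> r k = [])}"
  let ?F = "{f. \<forall>i. (i \<in> customers I \<longrightarrow> f i \<in> insert 0 (machines I)) \<and>
    (i \<notin> customers I \<longrightarrow> f i = (0::nat))}"
  let ?A = "{a. \<forall>k. (k \<in> vehicles I \<longrightarrow> a k \<in> ?F) \<and> (k \<notin> vehicles I \<longrightarrow> a k = (\<lambda>i. 0))}"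
  have fin: "finite (customers I)" "finite (vehicles I)" "finite (insert 0 (machines I))"
    by (auto simp: customers_def vehicles_def machines_def)
  have "finite ?R"
    using fin(2) finite_distinct_lists[OF fin(1)] by (rule finite_set_of_finite_funs)
  moreover have "finite ?F"
    using fin(1,3) by (rule finite_set_of_finite_funs)
  with fin(2) have "finite ?A" by (rule finite_set_of_finite_funs)
  ultimately have "finite ((\<lambda>(r, a). in_route_order r a) ` (?R \<times> ?A))" by blast
  moreover have "align I S \<in> (\<lambda>(r, a). in_route_order r a) ` (?R \<times> ?A)"
    if sol: "solution I S" for S
  proof (rule image_eqI)
    show "align I S = (\<lambda>(r, a). in_route_order r a)
        (\<lambda>k. if k \<in> vehicles I then route S k else [],
         \<lambda>k i. if k \<in> vehicles I \<and> i \<in> set (route S k) then machine_of S k i else 0)"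
      by (simp add: align_def)
  qed (use sol in \<open>auto simp: solution_def\<close>)
  ultimately show ?thesis by (auto intro: finite_subset)
qed


section \<open>Existence of an aligned optimal solution\<close>

theorem proposition1:
  fixes I :: mop_vrp
  assumes "mop_vrp_instance I"
    and "feasible_instance I"
  shows "\<exists>S. optimal_solution I S \<and>
           (\<forall>k \<in> vehicles I. \<forall>l \<in> machines I.
              \<forall>i \<in> set (schedule S k l). \<forall>j \<in> set (schedule S k l).
                before_in (schedule S k l) i j \<longleftrightarrow> before_in (route S k) i j)"
proof -
  let ?X = "align I ` {S. feasible_solution I S}"
  have "?X \<noteq> {}" using assms(2) by (auto simp: feasible_instance_def)
  moreover have "finite ?X"
    by (rule finite_subset[OF _ finite_aligned_solutions[of I]])
      (auto simp: feasible_solution_def)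
  ultimately obtain S where S: "S \<in> ?X" "\<forall>T\<in>?X. objective I S \<le> objective I T"
    by (metis arg_min_least arg_min_if_finite(1))
  have "objective I S \<le> objective I T" if T: "feasible_solution I T" for T
  proof -
    have "objective I S \<le> objective I (align I T)" using S(2) T by blast
    also have "\<dots> \<le> objective I T"
      using objective_align_le[OF assms(1)] T by (simp add: feasible_solution_def)
    finally show ?thesis .
  qed
  moreover have "feasible_solution I S"
    using S(1) feasible_solution_align[OF assms(1)] by blast
  ultimately have "optimal_solution I S" by (simp add: optimal_solution_def)
  moreover have "before_in (schedule S k l) i j \<longleftrightarrow> before_in (route S k) i j"
    if "k \<in> vehicles I" "i \<in> set (schedule S k l)" "j \<in> set (schedule S k l)" for k l i j
    using S(1) that by (auto simp: before_in_filter)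
  ultimately show ?thesis by blast
qed

end
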